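(* Let $k \in [0, 0.5)$. The social welfare functional $k\text{-}\mathit{thm}$ ($k$-trimmed Highest Mean) is not $k'$-fanatical for any $k' \in (0,0.5)$ with $k' \le k$, but it is $k^*$-fanatical for any $k^* \in (0,0.5)$ with $k^* > k$.
   Context: **Ethical frameworks.** Let $A$ be a set of actions. An ethical theory on $A$ is a function $t: A \to \mathbb{R}$. An ethical framework is a pair $F = (T, c)$ where $T$ is a finite set of ethical theories on $A$ and $c: T \to (0,1]$ is a credence function with $\sum_{t \in T} c(t) = 1$. **Social welfare functionals.** A social welfare functional $f$ assigns to every set of actions $A$ and every ethical framework $F$ on $A$ a total preorder $f(F, A)$ on $A$ (a complete, reflexive, transitive relation; ties are allowed). Two such orderings are equal iff they are equal as relations on $A$. **$k$-trimmed Highest Mean.** Fix $k \in [0,0.5)$. For $F = (T,c)$ with $n = |T|$ and $a \in A$, let $\mathit{se}(F,a)$ be the list of the evaluations $t(a)$, $t \in T$, sorted in non-descending order, and let $\mathit{st}(F,a)$ be the list of the theories corresponding to the sorted evaluations, i.e. the $i$th element $\mathit{st}(F,a)_i$ is $t$ iff the $i$th element $\mathit{se}(F,a)_i$ is $t(a)$. Define - $\mathit{bottom}_k(a) = \{\mathit{st}(F,a)_i \mid 1 \le i < \mathit{kend}\}$, where $\mathit{kend}$ is such that $\sum_{i \in [1,\mathit{kend})} c(\mathit{st}(F,a)_i) \le k$ and $\sum_{i \in [1,\mathit{kend}+1)} c(\mathit{st}(F,a)_i) > k$; - $\mathit{top}_k(a) = \{\mathit{st}(F,a)_i \mid \mathit{kstart}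 < i \le n\}$, where $\mathit{kstart}$ is such that $\sum_{i \in (\mathit{kstart}, n]} c(\mathit{st}(F,a)_i) \le k$ and $\sum_{i \in (\mathit{kstart}-1, n]} c(\mathit{st}(F,a)_i) > k$. For $a \in A$ let $c_a(t) = 0$ if $t \in \mathit{bottom}_k(a) \cup \mathit{top}_k(a)$ and $c_a(t) = c(t)$ otherwise. Then $k\text{-}\mathit{thm}(F,A) = \preceq$ where, for $a,b \in A$, $a \preceq b$ iff $\sum_{t \in T} c_a(t)\, t(a) \le \sum_{t \in T} c_b(t)\, t(b)$. **Restriction.** Given $F = (T,c)$ and a subset $T' \subset T$, the framework obtained by restricting $F$ to $T'$ is $(T', c')$ with $c'(t) = c(t) / \sum_{s \in T'} c(s)$ for $t \in T'$. **Extension.** Given $F = (T,c)$ and $T' \supset T$, a framework $F' = (T', c')$ is obtained by extending $F$ with $T'$ if for every $t \in T$, $c'(t) = n \cdot c(t)$, where $n = \frac{1 - \sum_{s \in T' \setminus T} c'(s)}{\sum_{s \in T} c(s)}$. (There are multiple ways of extending $F$ with $T'$, individuated by the credences $c'$ of the theories in $T' \setminus T$.) **Dominant subset.** Let $F = (T,c)$ be a framework, $A$ a set of actions and $f$ a social welfare functional. A subset $T_d \subset T$ is a dominant subset (given $F$, $A$, $f$) if $f(F,A) = f(F_d,A)$ and $f(F_d,A) \neq f(F_y,A)$, where $F_d$ is $F$ restricted to $T_d$ and $F_y$ is $F$ restricted to $T \setminus T_d$. **Fanaticism.** For $\kappa \in (0,0.5)$, a social welfare functional $f$ is $\kappa$-fanatical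 if for any set of actions $A$ and any ethical framework $F_y = (T_y, c_y)$ on $A$, there exists a framework $F = (T,c)$ obtained by extending $F_y$ with $T = T_d \cup T_y$, where $T_d \neq \emptyset$ is a set of theories disjoint from $T_y$ that is a dominant subset given $F$, $A$ and $f$, and $\sum_{t \in T_d} c(t) \le \kappa$.
   Formalization: Fanaticism is required only for sets of actions with at least two actions (with one action no dominant subset exists), and ties in st(F,a), left undefined, are broken by any rule preserved when F is restricted to a subset of theories. *)

theory Defs
  imports Complex_Main "HOL-Library.FuncSet"
begin

text \<open>Actions live in an arbitrary universe \<open>'a\<close>; a set of actions is an \<open>A :: 'a set\<close>. A theory on
  \<open>A\<close> is a total function that is \<open>undefined\<close> outside \<open>A\<close>, and a credence function on \<open>T\<close> is
  \<open>undefined\<close> outside \<open>T\<close>, so that equality of theories (frameworks) is equality of functions on \<open>A\<close>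
  (on \<open>T\<close>).\<close>

type_synonym 'a ethical_theory = "'a \<Rightarrow> real"
type_synonym 'a framework = "'a ethical_theory set \<times> ('a ethical_theory \<Rightarrow> real)"
type_synonym 'a swf = "'a framework \<Rightarrow> 'a set \<Rightarrow> ('a \<times> 'a) set"

definition ethical_framework :: "'a set \<Rightarrow> 'a framework \<Rightarrow> bool" where
  "ethical_framework A F \<longleftrightarrow>
     finite (fst F) \<and> fst F \<subseteq> (A \<rightarrow>\<^sub>E UNIV) \<and>
     snd F \<in> fst F \<rightarrow>\<^sub>E {0<..1} \<and> (\<Sum>t\<in>fst F. snd F t) = 1"

text \<open>An ordering is the relation \<open>{(a, b). a \<preceq> b}\<close> on \<open>A\<close>.\<close>

definition social_welfare_functional :: "'a swf \<Rightarrow> bool" where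
  "social_welfare_functional f \<longleftrightarrow>
     (\<forall>A F. ethical_framework A F \<longrightarrow> preorder_on A (f F A) \<and> total_on A (f F A))"

definition restrict_framework :: "'a framework \<Rightarrow> 'a ethical_theory set \<Rightarrow> 'a framework" where
  "restrict_framework F T' = (T', \<lambda>t\<in>T'. snd F t / (\<Sum>s\<in>T'. snd F s))"

text \<open>\<open>is_extension A F F'\<close>: the framework \<open>F'\<close> on \<open>A\<close> is obtained by extending \<open>F\<close> with the set of
  theories of \<open>F'\<close>.\<close>

definition is_extension :: "'a set \<Rightarrow> 'a framework \<Rightarrow> 'a framework \<Rightarrow> bool" where
  "is_extension A F F' \<longleftrightarrow>
     ethical_framework A F' \<and> fst F \<subset> fst F' \<and>
     (let n = (1 - (\<Sum>s\<in>fst F' - fst F. snd F' s)) / (\<Sum>s\<in>fst F. snd F s)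
      in \<forall>t\<in>fst F. snd F' t = n * snd F t)"

definition dominant_subset ::
  "'a framework \<Rightarrow> 'a set \<Rightarrow> 'a swf \<Rightarrow> 'a ethical_theory set \<Rightarrow> bool" where
  "dominant_subset F A f Td \<longleftrightarrow>
     Td \<subset> fst F \<and>
     f F A = f (restrict_framework F Td) A \<and>
     f (restrict_framework F Td) A \<noteq> f (restrict_framework F (fst F - Td)) A"

text \<open>Sets of actions are required to offer a choice, i.e. to contain two distinct actions. On a set
  with at most one action there is only one preorder, so no subset is dominant and no functional
  whatsoever would be fanatical.\<close>

definition fanatical :: "real \<Rightarrow> 'a swf \<Rightarrow> bool" where
  "fanatical \<kappa> f \<longleftrightarrow>
     (\<forall>A Fy. (\<exists>a\<in>A. \<exists>b\<in>A. a \<noteq> b) \<and> ethical_framework A Fy \<longrightarrow>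
       (\<exists>F Td. is_extension A Fy F \<and> fst F = Td \<union> fst Fy \<and>
          Td \<noteq> {} \<and> Td \<inter> fst Fy = {} \<and>
          dominant_subset F A f Td \<and> (\<Sum>t\<in>Td. snd F t) \<le> \<kappa>))"

text \<open>\<open>st F a\<close> lists the theories of \<open>F\<close> in non-descending order of their evaluation of \<open>a\<close>. When
  theories of different credence agree on \<open>a\<close>, the trimmed sum depends on how the tie is broken, so
  \<open>st\<close> is a parameter. Ties may be broken in any way, in particular depending on the action, as long
  as the relative order of two theories does not change when other theories are dropped from the
  framework and the credences renormalised. Breaking ties by a fixed linear order on theories is an
  instance, see \<open>tie_breaking_by_linear_order\<close> below.\<close>

definition theory_sorting :: "('a framework \<Rightarrow> 'a \<Rightarrow> 'a ethical_theory list) \<Rightarrow> bool" where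
  "theory_sorting st \<longleftrightarrow>
     (\<forall>A F a. ethical_framework A F \<and> a \<in> A \<longrightarrow>
        set (st F a) = fst F \<and> distinct (st F a) \<and> sorted (map (\<lambda>t. t a) (st F a)) \<and>
        (\<forall>T'. T' \<subseteq> fst F \<and> T' \<noteq> {} \<longrightarrow>
           st (restrict_framework F T') a = filter (\<lambda>t. t \<in> T') (st F a)))"

text \<open>Positions in the sorted list \<open>l\<close> are counted from 1, so the \<open>i\<close>-th element is \<open>l ! (i - 1)\<close>.\<close>

definition kend :: "real \<Rightarrow> ('a ethical_theory \<Rightarrow> real) \<Rightarrow> 'a ethical_theory list \<Rightarrow> nat" where
  "kend k c l = (THE m. m \<in> {1..length l} \<and>
     (\<Sum>i\<in>{1..<m}. c (l ! (i - 1))) \<le> k \<and> (\<Sum>i\<in>{1..<m + 1}. c (l ! (i - 1))) > k)"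

definition kstart :: "real \<Rightarrow> ('a ethical_theory \<Rightarrow> real) \<Rightarrow> 'a ethical_theory list \<Rightarrow> nat" where
  "kstart k c l = (THE m. m \<in> {1..length l} \<and>
     (\<Sum>i\<in>{m<..length l}. c (l ! (i - 1))) \<le> k \<and>
     (\<Sum>i\<in>{m - 1<..length l}. c (l ! (i - 1))) > k)"

definition bottom_trim ::
  "real \<Rightarrow> ('a ethical_theory \<Rightarrow> real) \<Rightarrow> 'a ethical_theory list \<Rightarrow> 'a ethical_theory set" where
  "bottom_trim k c l = {l ! (i - 1) | i. 1 \<le> i \<and> i < kend k c l}"

definition top_trim ::
  "real \<Rightarrow> ('a ethical_theory \<Rightarrow> real) \<Rightarrow> 'a ethical_theory list \<Rightarrow> 'a ethical_theory set" where
  "top_trim k c l = {l ! (i - 1) | i. kstart k c l < i \<and> i \<le> length l}"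

definition trimmed_credence ::
  "real \<Rightarrow> ('a framework \<Rightarrow> 'a \<Rightarrow> 'a ethical_theory list) \<Rightarrow> 'a framework \<Rightarrow> 'a \<Rightarrow>
   'a ethical_theory \<Rightarrow> real" where
  "trimmed_credence k st F a t =
     (if t \<in> bottom_trim k (snd F) (st F a) \<union> top_trim k (snd F) (st F a) then 0 else snd F t)"

definition k_thm ::
  "real \<Rightarrow> ('a framework \<Rightarrow> 'a \<Rightarrow> 'a ethical_theory list) \<Rightarrow> 'a swf" where
  "k_thm k st F A = {(a, b). a \<in> A \<and> b \<in> A \<and>
     (\<Sum>t\<in>fst F. trimmed_credence k st F a t * t a) \<le>
     (\<Sum>t\<in>fst F. trimmed_credence k st F b t * t b)}"

lemma social_welfare_functional_k_thm: "social_welfare_functional (k_thm k st)"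
  unfolding social_welfare_functional_def preorder_on_def total_on_def k_thm_def
  by (auto simp: refl_on_def trans_def)

text \<open>\<open>kend\<close> and \<open>kstart\<close> are well defined on the lists that \<open>k_thm\<close> applies them to.\<close>

lemma threshold_ex1:
  fixes S :: "nat \<Rightarrow> real"
  assumes "S 0 \<le> k" "k < S n" "\<And>m. m < n \<Longrightarrow> S m < S (Suc m)"
  shows "\<exists>!m. m < n \<and> S m \<le> k \<and> k < S (Suc m)"
proof -
  have mono: "S i \<le> S j" if "i \<le> j" "j \<le> n" for i j
    using that
  proof (induction j rule: dec_induct)
    case (step m)
    then show ?case using assms(3)[of m] by simp
  qed simp
  define m where "m = (LEAST m. k < S m)"
  have m: "k < S m" "m \<le> n"
    unfolding m_def using assms(2) by (auto intro: LeastI Least_le)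
  have below: "S i \<le> k" if "i < m" for i
    using not_less_Least that unfolding m_def by fastforce
  obtain p where p: "m = Suc p"
    using m(1) assms(1) by (cases m) auto
  show ?thesis
  proof (rule ex1I)
    show "p < n \<and> S p \<le> k \<and> k < S (Suc p)"
      using p m below by simp
    fix q assume q: "q < n \<and> S q \<le> k \<and> k < S (Suc q)"
    show "q = p"
    proof (rule ccontr)
      assume "q \<noteq> p"
      then consider "Suc q \<le> p" | "Suc p \<le> q" by linarith
      then show False
      proof cases
        case 1
        then show False using mono[of "Suc q" p] q p m below[of p] by simp
      next
        case 2
        then show False using mono[of "Suc p" q] q p m by simp
      qed
    qed
  qed
qed

lemma
  assumes F: "ethical_framework A F" and k: "0 \<le> k" "k < 1/2"
    and l: "set l = fst F" "distinct l"
  shows kend_ex1: "\<exists>!m. m \<in> {1..length l} \<and>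
      (\<Sum>i\<in>{1..<m}. snd F (l ! (i - 1))) \<le> k \<and> (\<Sum>i\<in>{1..<m + 1}. snd F (l ! (i - 1))) > k"
    and kstart_ex1: "\<exists>!m. m \<in> {1..length l} \<and>
      (\<Sum>i\<in>{m<..length l}. snd F (l ! (i - 1))) \<le> k \<and>
      (\<Sum>i\<in>{m - 1<..length l}. snd F (l ! (i - 1))) > k"
proof -
  define n where "n = length l"
  define w where "w i = snd F (l ! (i - 1))" for i
  have pos: "w i > 0" if "1 \<le> i" "i \<le> n" for i
  proof -
    have "l ! (i - 1) \<in> fst F" using that l(1) nth_mem[of "i - 1" l] by (auto simp: n_def)
    then show ?thesis using F unfolding ethical_framework_def w_def by auto
  qed
  have "(\<Sum>i\<in>{1..<n + 1}. w i) = (\<Sum>i<n. snd F (l ! i))"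
    unfolding w_def by (rule sum.reindex_bij_witness[of _ Suc "\<lambda>i. i - 1"]) auto
  also have "\<dots> = (\<Sum>t\<in>fst F. snd F t)"
    using l by (intro sum.reindex_bij_betw[of "(!) l" "{..<n}" "fst F" "snd F"])
      (auto simp: n_def intro: bij_betw_nth)
  also have "\<dots> = 1" using F unfolding ethical_framework_def by simp
  finally have total: "(\<Sum>i\<in>{1..<n + 1}. w i) = 1" .

  have "\<exists>!m. m < n \<and> (\<Sum>i\<in>{1..<m + 1}. w i) \<le> k \<and> k < (\<Sum>i\<in>{1..<Suc m + 1}. w i)"
    by (rule threshold_ex1[of "\<lambda>m. \<Sum>i\<in>{1..<m + 1}. w i"]) (use k total pos in auto)
  then obtain m where m: "m < n" "(\<Sum>i\<in>{1..<m + 1}. w i) \<le> k" "k < (\<Sum>i\<in>{1..<Suc m + 1}. w i)"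
    and m_unique: "\<And>q. q < n \<Longrightarrow> (\<Sum>i\<in>{1..<q + 1}. w i) \<le> k \<Longrightarrow>
      k < (\<Sum>i\<in>{1..<Suc q + 1}. w i) \<Longrightarrow> q = m"
    by blast
  have "\<exists>!m. m \<in> {1..n} \<and> (\<Sum>i\<in>{1..<m}. w i) \<le> k \<and> (\<Sum>i\<in>{1..<m + 1}. w i) > k"
  proof (rule ex1I[of _ "Suc m"])
    show "Suc m \<in> {1..n} \<and> (\<Sum>i\<in>{1..<Suc m}. w i) \<le> k \<and> (\<Sum>i\<in>{1..<Suc m + 1}. w i) > k"
      using m by simp
    fix q assume "q \<in> {1..n} \<and> (\<Sum>i\<in>{1..<q}. w i) \<le> k \<and> (\<Sum>i\<in>{1..<q + 1}. w i) > k"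
    then show "q = Suc m" using m_unique[of "q - 1"] by auto
  qed
  then show "\<exists>!m. m \<in> {1..length l} \<and>
      (\<Sum>i\<in>{1..<m}. snd F (l ! (i - 1))) \<le> k \<and> (\<Sum>i\<in>{1..<m + 1}. snd F (l ! (i - 1))) > k"
    unfolding n_def w_def .

  have upper: "{n - Suc m<..n} = insert (n - m) {n - m<..n}" if "m < n" for m
    using that by auto
  have "{0<..n} = {1..<n + 1}" by auto
  then have "\<exists>!m. m < n \<and> (\<Sum>i\<in>{n - m<..n}. w i) \<le> k \<and> k < (\<Sum>i\<in>{n - Suc m<..n}. w i)"
    by (intro threshold_ex1[of "\<lambda>m. \<Sum>i\<in>{n - m<..n}. w i"]) (use k total pos in \<open>auto simp: upper\<close>)
  then obtain m where m: "m < n" "(\<Sum>i\<in>{n - m<..n}. w i) \<le> k" "k < (\<Sum>i\<in>{n - Suc m<..n}. w i)"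
    and m_unique: "\<And>q. q < n \<Longrightarrow> (\<Sum>i\<in>{n - q<..n}. w i) \<le> k \<Longrightarrow>
      k < (\<Sum>i\<in>{n - Suc q<..n}. w i) \<Longrightarrow> q = m"
    by blast
  have "\<exists>!m. m \<in> {1..n} \<and> (\<Sum>i\<in>{m<..n}. w i) \<le> k \<and> (\<Sum>i\<in>{m - 1<..n}. w i) > k"
  proof (rule ex1I[of _ "n - m"])
    show "n - m \<in> {1..n} \<and> (\<Sum>i\<in>{n - m<..n}. w i) \<le> k \<and> (\<Sum>i\<in>{n - m - 1<..n}. w i) > k"
      using m by auto
    fix q assume q: "q \<in> {1..n} \<and> (\<Sum>i\<in>{q<..n}. w i) \<le> k \<and> (\<Sum>i\<in>{q - 1<..n}. w i) > k"
    then have "n - q < n" "n - (n - q) = q" "n - Suc (n - q) = q - 1" by auto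
    then have "n - q = m" using m_unique[of "n - q"] q by simp
    then show "q = n - m" using q by auto
  qed
  then show "\<exists>!m. m \<in> {1..length l} \<and>
      (\<Sum>i\<in>{m<..length l}. snd F (l ! (i - 1))) \<le> k \<and>
      (\<Sum>i\<in>{m - 1<..length l}. snd F (l ! (i - 1))) > k"
    unfolding n_def w_def .
qed

lemma tie_breaking_by_linear_order:
  fixes r :: "'a ethical_theory rel"
  assumes r: "linear_order r"
  obtains st where "theory_sorting st"
    and "\<And>A F a. ethical_framework A F \<Longrightarrow> a \<in> A \<Longrightarrow>
      sorted_wrt (\<lambda>t s. t a < s a \<or> t a = s a \<and> (t, s) \<in> r) (st F a)"
proof -
  define le where "le a t s \<longleftrightarrow> t a < s a \<or> t a = s a \<and> (t, s) \<in> r" for a and t s :: "'a \<Rightarrow> real"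
  define lt where "lt a t s \<longleftrightarrow> le a t s \<and> t \<noteq> s" for a and t s :: "'a \<Rightarrow> real"
  have refl: "(t, t) \<in> r" and total: "(t, s) \<in> r \<or> (s, t) \<in> r" for t s
    using r unfolding linear_order_on_def partial_order_on_def preorder_on_def refl_on_def total_on_def
    by (auto, metis)
  have antisym: "t = s" if "(t, s) \<in> r" "(s, t) \<in> r" for t s
    using r that unfolding linear_order_on_def partial_order_on_def antisym_def by blast
  have trans: "(t, u) \<in> r" if "(t, s) \<in> r" "(s, u) \<in> r" for t s u
    using r that unfolding linear_order_on_def partial_order_on_def preorder_on_def
    by (blast dest: transD)
  have lin: "class.linorder (le a) (lt a)" for a
  proof
    fix t s u :: "'a \<Rightarrow> real"
    show "lt a t s \<longleftrightarrow> le a t s \<and> \<not> le a s t"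
      unfolding lt_def le_def using antisym[of t s] refl[of t] by auto
    show "le a t t" unfolding le_def using refl by simp
    show "le a t u" if "le a t s" "le a s u"
      using that trans[of t s u] unfolding le_def by auto
    show "t = s" if "le a t s" "le a s t"
      using that antisym[of t s] unfolding le_def by auto
    show "le a t s \<or> le a s t"
      using total[of t s] unfolding le_def by linarith
  qed
  define st where "st F a = linorder.sorted_list_of_set (le a) (fst F)" for F :: "'a framework" and a
  have st: "set (st F a) = fst F" "distinct (st F a)" "sorted_wrt (le a) (st F a)"
    if "finite (fst F)" for F :: "'a framework" and a
  proof -
    interpret linorder "le a" "lt a" by (rule lin)
    show "set (st F a) = fst F" "distinct (st F a)" "sorted_wrt (le a) (st F a)"
      unfolding st_def using that by auto
  qed
  have "theory_sorting st"
    unfolding theory_sorting_def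
  proof (intro allI impI conjI)
    fix A a and F :: "'a framework"
    assume "ethical_framework A F \<and> a \<in> A"
    then have fin: "finite (fst F)" unfolding ethical_framework_def by simp
    show "set (st F a) = fst F" "distinct (st F a)" using st fin by auto
    show "sorted (map (\<lambda>t. t a) (st F a))"
      unfolding sorted_map using st(3)[OF fin]
      by (rule sorted_wrt_mono_rel[rotated]) (auto simp: le_def)
    fix T' assume T': "T' \<subseteq> fst F \<and> T' \<noteq> {}"
    define F' where "F' = restrict_framework F T'"
    have F': "fst F' = T'" "finite (fst F')"
      using T' fin finite_subset by (auto simp: F'_def restrict_framework_def)
    interpret linorder "le a" "lt a" by (rule lin)
    have "st F' a = filter (\<lambda>t. t \<in> T') (st F a)"
      using st[OF fin, of a] st[OF F'(2), of a] F' T'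
      by (intro sorted_distinct_set_unique) (auto intro: sorted_wrt_filter)
    then show "st (restrict_framework F T') a = filter (\<lambda>t. t \<in> T') (st F a)"
      unfolding F'_def .
  qed
  then show ?thesis
    using that st(3) unfolding le_def ethical_framework_def by blast
qed

end

theory Submission
  imports Defs
begin

text \<open>Not fanatical for \<open>k' \<le> k\<close>: take a framework with a single theory. In an extension, the new
  theories have total credence at most \<open>k\<close>, so all of them are trimmed, below or above the old one.

  Fanatical for \<open>q > k\<close>: add one theory \<open>s\<close> of credence \<open>q\<close> that lies above all old theories. It is
  never trimmed, and the trimmed sum is \<open>q * s x + R x\<close>, where \<open>R\<close> does not depend on \<open>s\<close>. Since \<open>R\<close> may
  be unbounded on an infinite set of actions, making \<open>s\<close> large does not suffice for \<open>s\<close> and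
  \<open>q * s + R\<close> to induce the same order. With \<open>s x = C * (N x)\<^sup>2 + R x\<close>, where the natural
  number \<open>N x\<close> bounds \<open>R x\<close> and \<open>C\<close> is large, both orders are lexicographic in \<open>(N x, R x)\<close>.
  Increasing \<open>N\<close> at one action then reverses the old order of two actions.\<close>

section \<open>Trimming expressed through credences of prefixes and suffixes\<close>

lemma ethical_framework_pos: "ethical_framework A F \<Longrightarrow> t \<in> fst F \<Longrightarrow> 0 < snd F t"
  unfolding ethical_framework_def by (auto dest: PiE_mem)

lemma sum_one_based_nth:
  fixes c :: "'b \<Rightarrow> real"
  assumes "distinct l" "I \<subseteq> {1..length l}"
  shows "(\<Sum>i\<in>I. c (l ! (i - 1))) = sum c ((\<lambda>i. l ! (i - 1)) ` I)"
proof -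
  have "inj_on (\<lambda>i. l ! (i - 1)) I"
  proof (rule inj_onI)
    fix i j assume "i \<in> I" "j \<in> I" "l ! (i - 1) = l ! (j - 1)"
    moreover from this have "i \<in> {1..length l}" "j \<in> {1..length l}" using assms(2) by blast+
    ultimately show "i = j" using nth_eq_iff_index_eq[OF assms(1), of "i - 1" "j - 1"] by force
  qed
  then show ?thesis by (simp add: sum.reindex)
qed

lemma one_based_nth_image_take:
  assumes "m \<le> length l"
  shows "(\<lambda>i. l ! (i - 1)) ` {1..<m + 1} = set (take m l)"
proof -
  have "{1..<m + 1} = Suc ` {0..<m}" by (simp add: image_Suc_atLeastLessThan)
  then have "(\<lambda>i. l ! (i - 1)) ` {1..<m + 1} = (!) l ` {0..<m}"
    by (simp only: image_image diff_Suc_1)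
  then show ?thesis using assms by (simp add: nth_image)
qed

lemma one_based_nth_image_drop:
  "(\<lambda>i. l ! (i - 1)) ` {m<..length l} = set (drop m l)"
proof -
  have "{m<..length l} = (\<lambda>i. Suc (m + i)) ` {..<length l - m}"
  proof (intro equalityI subsetI)
    fix i assume "i \<in> {m<..length l}"
    then show "i \<in> (\<lambda>i. Suc (m + i)) ` {..<length l - m}"
      by (intro image_eqI[of _ _ "i - Suc m"]) auto
  qed auto
  then have "(\<lambda>i. l ! (i - 1)) ` {m<..length l} = (\<lambda>i. l ! (m + i)) ` {..<length l - m}"
    by (simp only: image_image diff_Suc_1)
  then show ?thesis by (auto simp: set_conv_nth)
qed

text \<open>This eliminates \<open>kend\<close> and \<open>kstart\<close>. Credences are
  nonnegative, so a longer prefix weighs at least as much as a shorter one, and the threshold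
  position is passed exactly when the prefix ending in \<open>t\<close> weighs more than
  \<open>k\<close>; suffixes are symmetric.\<close>

lemma trim_iff:
  assumes F: "ethical_framework A F" and k: "0 \<le> k" "k < 1/2"
    and l: "set l = fst F" "distinct l" "l = xs @ t # ys"
  shows bottom_trim_iff: "t \<in> bottom_trim k (snd F) l \<longleftrightarrow> sum (snd F) (insert t (set xs)) \<le> k"
    and top_trim_iff: "t \<in> top_trim k (snd F) l \<longleftrightarrow> sum (snd F) (insert t (set ys)) \<le> k"
proof -
  let ?c = "snd F" and ?j = "length xs"
  have pos: "0 \<le> ?c u" if "u \<in> set l" for u
    using ethical_framework_pos[OF F] l(1) that by (simp add: less_imp_le)
  have mono: "sum ?c U \<le> sum ?c W" if "U \<subseteq> W" "W \<subseteq> set l" for U W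
    using that pos by (intro sum_mono2) (auto intro: finite_subset)
  have at_t: "l ! (i - 1) = t \<longleftrightarrow> i = Suc ?j" if "1 \<le> i" "i \<le> length l" for i
    using nth_eq_iff_index_eq[OF l(2), of "i - 1" ?j] that by (auto simp: l(3))
  have prefix: "(\<Sum>i\<in>{1..<m + 1}. ?c (l ! (i - 1))) = sum ?c (set (take m l))"
    if "m \<le> length l" for m
  proof -
    have "{1..<m + 1} \<subseteq> {1..length l}" using that by auto
    from sum_one_based_nth[OF l(2) this] show ?thesis
      by (simp only: one_based_nth_image_take[OF that])
  qed
  have suffix: "(\<Sum>i\<in>{m<..length l}. ?c (l ! (i - 1))) = sum ?c (set (drop m l))" for m
  proof -
    have "{m<..length l} \<subseteq> {1..length l}" by auto
    from sum_one_based_nth[OF l(2) this] show ?thesis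
      by (simp only: one_based_nth_image_drop)
  qed
  have take_t: "set (take (Suc ?j) l) = insert t (set xs)"
    and drop_t: "set (drop ?j l) = insert t (set ys)"
    by (simp_all add: l(3))

  define m where "m = kend k ?c l"
  have m': "m \<in> {1..length l} \<and> (\<Sum>i\<in>{1..<m}. ?c (l ! (i - 1))) \<le> k \<and>
      (\<Sum>i\<in>{1..<m + 1}. ?c (l ! (i - 1))) > k"
    unfolding m_def kend_def by (rule theI'[OF kend_ex1[OF F k l(1,2)]])
  \<comment> \<open>Since \<open>m\<close> is at least 1, the index set \<open>{1..<m}\<close>
    describes the prefix of length \<open>m - 1\<close>, and \<open>prefix\<close> applies.\<close>
  then have "m - 1 + 1 = m" "m - 1 \<le> length l" by auto
  with m' prefix[of m] prefix[of "m - 1"] have m: "1 \<le> m" "m \<le> length l"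
    "sum ?c (set (take (m - 1) l)) \<le> k" "k < sum ?c (set (take m l))"
    by (simp_all only: atLeastAtMost_iff)
  have "t \<in> bottom_trim k ?c l \<longleftrightarrow> (\<exists>i. (1 \<le> i \<and> i < m) \<and> l ! (i - 1) = t)"
    unfolding bottom_trim_def m_def[symmetric] by blast
  also have "\<dots> \<longleftrightarrow> (\<exists>i. (1 \<le> i \<and> i < m) \<and> i = Suc ?j)"
    using m(2) by (intro iff_exI conj_cong refl at_t) auto
  also have "\<dots> \<longleftrightarrow> Suc ?j < m" by auto
  also have "\<dots> \<longleftrightarrow> sum ?c (set (take (Suc ?j) l)) \<le> k"
  proof
    assume "Suc ?j < m"
    then show "sum ?c (set (take (Suc ?j) l)) \<le> k"
      using mono[OF set_take_subset_set_take set_take_subset, of "Suc ?j" "m - 1"] m(3) by linarith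
  next
    assume "sum ?c (set (take (Suc ?j) l)) \<le> k"
    then show "Suc ?j < m"
      using mono[OF set_take_subset_set_take set_take_subset, of m "Suc ?j"] m(4) by linarith
  qed
  finally show "t \<in> bottom_trim k ?c l \<longleftrightarrow> sum ?c (insert t (set xs)) \<le> k"
    unfolding take_t .

  define p where "p = kstart k ?c l"
  have "p \<in> {1..length l} \<and> (\<Sum>i\<in>{p<..length l}. ?c (l ! (i - 1))) \<le> k \<and>
      (\<Sum>i\<in>{p - 1<..length l}. ?c (l ! (i - 1))) > k"
    unfolding p_def kstart_def by (rule theI'[OF kstart_ex1[OF F k l(1,2)]])
  then have p: "1 \<le> p" "sum ?c (set (drop p l)) \<le> k" "k < sum ?c (set (drop (p - 1) l))"
    unfolding suffix by auto
  have "t \<in> top_trim k ?c l \<longleftrightarrow> (\<exists>i. (p < i \<and> i \<le> length l) \<and> l ! (i - 1) = t)"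
    unfolding top_trim_def p_def[symmetric] by blast
  also have "\<dots> \<longleftrightarrow> (\<exists>i. (p < i \<and> i \<le> length l) \<and> i = Suc ?j)"
    by (intro iff_exI conj_cong refl at_t) auto
  also have "\<dots> \<longleftrightarrow> p \<le> ?j" by (auto simp: l(3))
  also have "\<dots> \<longleftrightarrow> sum ?c (set (drop ?j l)) \<le> k"
  proof
    assume "p \<le> ?j"
    then show "sum ?c (set (drop ?j l)) \<le> k"
      using mono[OF set_drop_subset_set_drop set_drop_subset, of p ?j] p(2) by linarith
  next
    assume "sum ?c (set (drop ?j l)) \<le> k"
    then show "p \<le> ?j"
      using mono[OF set_drop_subset_set_drop set_drop_subset, of ?j "p - 1"] p(3) by linarith
  qed
  finally show "t \<in> top_trim k ?c l \<longleftrightarrow> sum ?c (insert t (set ys)) \<le> k"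
    unfolding drop_t .
qed

lemma theory_sortingD:
  assumes "theory_sorting st" "ethical_framework A F" "a \<in> A"
  shows "set (st F a) = fst F" "distinct (st F a)" "sorted (map (\<lambda>t. t a) (st F a))"
    and "T' \<subseteq> fst F \<Longrightarrow> T' \<noteq> {} \<Longrightarrow>
      st (restrict_framework F T') a = filter (\<lambda>t. t \<in> T') (st F a)"
  using assms unfolding theory_sorting_def by blast+

section \<open>Added theories of total credence at most \<open>k\<close>\<close>

text \<open>The list position of \<open>t\<close> is before or after that of \<open>u\<close>.
  Accordingly the prefix ending in \<open>t\<close> or the suffix starting with \<open>t\<close>
  avoids \<open>u\<close>, hence weighs at most \<open>k\<close>.\<close>

lemma trimmed_credence_eq_0:
  assumes k: "0 \<le> k" "k < 1/2" and st: "theory_sorting st"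
    and F: "ethical_framework A F" and a: "a \<in> A"
    and u: "sum (snd F) (fst F - {u}) \<le> k" and t: "t \<in> fst F" "t \<noteq> u"
  shows "trimmed_credence k st F a t = 0"
proof -
  note s = theory_sortingD[OF st F a]
  have fin: "finite (fst F)" using F unfolding ethical_framework_def by simp
  obtain xs ys where l: "st F a = xs @ t # ys"
    using t(1) s(1) by (metis split_list)
  have le: "sum (snd F) W \<le> k" if "W \<subseteq> fst F - {u}" for W
    using that fin by (intro order_trans[OF sum_mono2 u])
      (auto intro: less_imp_le[OF ethical_framework_pos[OF F]])
  have sub: "insert t (set xs) \<subseteq> fst F" "insert t (set ys) \<subseteq> fst F"
    using s(1) l by auto
  have "u \<notin> insert t (set xs) \<or> u \<notin> insert t (set ys)"
    using s(2) t(2) by (auto simp: l)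
  then have "t \<in> bottom_trim k (snd F) (st F a) \<union> top_trim k (snd F) (st F a)"
    using trim_iff[OF F k s(1,2) l] le sub by blast
  then show ?thesis unfolding trimmed_credence_def by simp
qed

lemma ethical_framework_restrict:
  assumes F: "ethical_framework A F" and T': "T' \<subseteq> fst F" "T' \<noteq> {}"
  shows "ethical_framework A (restrict_framework F T')"
proof -
  have fin: "finite T'" using F T' finite_subset unfolding ethical_framework_def by blast
  have pos: "0 < snd F t" if "t \<in> T'" for t using ethical_framework_pos[OF F] T' that by blast
  have S: "0 < sum (snd F) T'" using fin pos T' by (intro sum_pos) auto
  have "snd F t \<le> sum (snd F) T'" if "t \<in> T'" for t
    using member_le_sum[of t T' "snd F"] fin pos that by (auto intro: less_imp_le)
  then show ?thesis
    using F T' fin pos S unfolding ethical_framework_def restrict_framework_def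
    by (auto simp: sum_divide_distrib[symmetric])
qed

text \<open>The single old theory is constantly 0, so it induces universal indifference. Every
  extension by theories of total credence at most \<open>k\<close> does too, whereas dominance would
  require the two orders to differ.\<close>

lemma k_thm_not_fanatical:
  fixes st :: "'a framework \<Rightarrow> 'a \<Rightarrow> 'a ethical_theory list"
  assumes k: "0 \<le> k" "k < 1/2" and st: "theory_sorting st" and ab: "(a :: 'a) \<noteq> b"
    and k': "k' \<le> k"
  shows "\<not> fanatical k' (k_thm k st)"
proof
  assume fan: "fanatical k' (k_thm k st)"
  let ?z = "\<lambda>_ :: 'a. 0 :: real"
  let ?Fy = "({?z}, \<lambda>t\<in>{?z}. 1) :: 'a framework"
  have "ethical_framework UNIV ?Fy" unfolding ethical_framework_def by auto
  moreover have "\<exists>a\<in>UNIV. \<exists>b\<in>UNIV. (a :: 'a) \<noteq> b" using ab by blast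
  ultimately obtain F Td where F: "is_extension UNIV ?Fy F" "fst F = Td \<union> fst ?Fy"
      "Td \<inter> fst ?Fy = {}"
    and dom: "dominant_subset F UNIV (k_thm k st) Td" and le: "sum (snd F) Td \<le> k'"
    using fan[unfolded fanatical_def, rule_format, of UNIV ?Fy] by blast
  have eF: "ethical_framework UNIV F" using F(1) unfolding is_extension_def by blast
  have Td: "fst F - {?z} = Td" "fst F - Td = {?z}" using F by auto
  \<comment> \<open>Added theories have trimmed credence 0; the old theory has value 0.\<close>
  have "trimmed_credence k st F x t * t x = 0" if "t \<in> fst F" for x t
    using trimmed_credence_eq_0[OF k st eF, of x ?z t] that le k' Td by auto
  then have "(\<Sum>t\<in>fst F. trimmed_credence k st F x t * t x) = 0" for x
    by (simp only: sum.neutral_const cong: sum.cong)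
  then have "k_thm k st F UNIV = UNIV" unfolding k_thm_def by simp
  moreover have "k_thm k st (restrict_framework F {?z}) UNIV = UNIV"
    unfolding k_thm_def restrict_framework_def by simp
  ultimately show False using dom Td unfolding dominant_subset_def by simp
qed

section \<open>Lexicographic comparison by perturbed squares\<close>

text \<open>Both sides compare the pairs \<open>(n, r)\<close> and \<open>(n', r')\<close> lexicographically.\<close>

lemma square_plus_le_iff:
  fixes q C r r' :: real and n n' :: nat
  assumes q: "0 < q" and C: "1 + 1 / q < C" and r: "\<bar>r\<bar> \<le> n" "\<bar>r'\<bar> \<le> n'"
  shows "C * real n ^ 2 + r \<le> C * real n' ^ 2 + r' \<longleftrightarrow>
    q * (C * real n ^ 2 + r) + r \<le> q * (C * real n' ^ 2 + r') + r'"
proof -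
  have qC: "1 + q < q * C" and C1: "1 < C"
    using C q mult_strict_left_mono[OF C q] zero_less_divide_1_iff[of q]
    by (simp add: distrib_left, linarith)
  \<comment> \<open>From \<open>m < m'\<close> the squares differ by at least \<open>m + m'\<close>,
    which also bounds \<open>u - u'\<close>. The factors \<open>C > 1\<close> and
    \<open>q * C > 1 + q\<close> make the two inequalities strict.\<close>
  have less: "C * real m ^ 2 + u < C * real m' ^ 2 + u' \<and>
      q * (C * real m ^ 2 + u) + u < q * (C * real m' ^ 2 + u') + u'"
    if "m < m'" "\<bar>u\<bar> \<le> m" "\<bar>u'\<bar> \<le> m'" for m m' :: nat and u u' :: real
  proof -
    have d: "real m + m' \<le> real m' ^ 2 - real m ^ 2" "0 < real m + m'"
    proof -
      have "1 \<le> real m' - m" using that(1) by linarith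
      then have "(real m + m') * 1 \<le> (real m + m') * (real m' - m)" by (intro mult_left_mono) auto
      then show "real m + m' \<le> real m' ^ 2 - real m ^ 2"
        by (simp add: power2_eq_square algebra_simps)
      show "0 < real m + m'" using that(1) by linarith
    qed
    have u: "u - u' \<le> real m + m'" using that(2,3) by linarith
    have "real m + m' < C * (real m + m')" using C1 d(2) by simp
    also have "\<dots> \<le> C * (real m' ^ 2 - real m ^ 2)" using C1 d(1) by (intro mult_left_mono) auto
    finally have 1: "u - u' < C * (real m' ^ 2 - real m ^ 2)" using u by linarith
    have "(1 + q) * (u - u') \<le> (1 + q) * (real m + m')" using u q by (intro mult_left_mono) auto
    also have "\<dots> < (q * C) * (real m + m')" using qC d(2) by (intro mult_strict_right_mono)
    also have "\<dots> \<le> (q * C) * (real m' ^ 2 - real m ^ 2)"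
      using qC q d(1) by (intro mult_left_mono) auto
    finally show ?thesis using 1 by (simp add: algebra_simps)
  qed
  consider "n < n'" | "n = n'" | "n' < n" by linarith
  then show ?thesis
  proof cases
    case 1
    then show ?thesis using less[OF 1 r] by simp
  next
    case 2
    have "r \<le> r' \<longleftrightarrow> (1 + q) * r \<le> (1 + q) * r'" using q by simp
    then show ?thesis by (simp add: 2 algebra_simps)
  next
    case 3
    then show ?thesis using less[OF 3 r(2,1)] by simp
  qed
qed

section \<open>Single theories and extensions by one theory\<close>

lemma k_thm_singleton:
  assumes k: "0 \<le> k" "k < 1/2" and st: "theory_sorting st"
    and F: "ethical_framework A F" "fst F = {s}"
  shows "k_thm k st F A = {(a, b). a \<in> A \<and> b \<in> A \<and> s a \<le> s b}"
proof -
  have c: "snd F s = 1" using F unfolding ethical_framework_def by simp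
  have "trimmed_credence k st F a s = 1" if a: "a \<in> A" for a
  proof -
    note s = theory_sortingD[OF st F(1) a]
    \<comment> \<open>The case rule separates lists of length 0, 1 and at least 2; distinctness
      excludes the last case. The only prefix and suffix ending or starting at \<open>s\<close> then
      weigh 1, more than \<open>k\<close>.\<close>
    have "st F a = [] @ s # []"
      using s(1,2) F(2) by (cases "st F a" rule: remdups_adj.cases) auto
    from trim_iff[OF F(1) k s(1,2) this] show ?thesis
      using k c unfolding trimmed_credence_def by simp
  qed
  then show ?thesis using F(2) unfolding k_thm_def by auto
qed

definition extend_framework ::
  "real \<Rightarrow> 'a ethical_theory \<Rightarrow> 'a framework \<Rightarrow> 'a framework" where
  "extend_framework q s F =
     (insert s (fst F), \<lambda>t\<in>insert s (fst F). if t = s then q else (1 - q) * snd F t)"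

lemma extend_framework:
  assumes F: "ethical_framework A F" and q: "0 < q" "q < 1"
    and s: "s \<in> A \<rightarrow>\<^sub>E UNIV" "s \<notin> fst F"
  shows ethical_framework_extend: "ethical_framework A (extend_framework q s F)"
    and is_extension_extend: "is_extension A F (extend_framework q s F)"
    and restrict_extend: "restrict_framework (extend_framework q s F) (fst F) = F"
proof -
  have sum: "(\<Sum>t\<in>fst F. snd (extend_framework q s F) t) = 1 - q"
  proof -
    have "(\<Sum>t\<in>fst F. snd (extend_framework q s F) t) = (\<Sum>t\<in>fst F. (1 - q) * snd F t)"
      using s(2) by (intro sum.cong) (auto simp: extend_framework_def)
    then show ?thesis using F by (simp add: sum_distrib_left[symmetric] ethical_framework_def)
  qed
  have c: "0 < (1 - q) * snd F t" "(1 - q) * snd F t \<le> 1" if "t \<in> fst F" for t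
  proof -
    have "snd F t \<in> {0<..1}" using F that unfolding ethical_framework_def by blast
    then show "0 < (1 - q) * snd F t" "(1 - q) * snd F t \<le> 1"
      using q by (auto intro: mult_le_one)
  qed
  have q': "snd (extend_framework q s F) s = q" by (simp add: extend_framework_def)
  have fin: "finite (fst F)" and T: "fst F \<subseteq> A \<rightarrow>\<^sub>E UNIV"
    using F unfolding ethical_framework_def by auto
  have fst: "fst (extend_framework q s F) = insert s (fst F)" by (simp add: extend_framework_def)
  show E: "ethical_framework A (extend_framework q s F)"
    unfolding ethical_framework_def
  proof (intro conjI)
    show "snd (extend_framework q s F) \<in> fst (extend_framework q s F) \<rightarrow>\<^sub>E {0<..1}"
      unfolding extend_framework_def snd_conv fst_conv using q c by (simp add: restrict_PiE_iff)
  qed (use fin T s sum q' fst in auto)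
  have diff: "insert s (fst F) - fst F = {s}" using s(2) by auto
  show "is_extension A F (extend_framework q s F)"
    unfolding is_extension_def fst Let_def diff using E s(2) F
    by (auto simp: extend_framework_def ethical_framework_def)
  \<comment> \<open>Equality of frameworks includes the credences off \<open>fst F\<close>, where
    both functions are \<open>undefined\<close>.\<close>
  have "snd F \<in> extensional (fst F)" using F unfolding ethical_framework_def by (auto simp: PiE_def)
  then have "(\<lambda>t\<in>fst F. snd (extend_framework q s F) t / (1 - q)) = snd F"
    using s(2) q by (intro extensionalityI[of _ "fst F"]) (auto simp: extend_framework_def)
  then show "restrict_framework (extend_framework q s F) (fst F) = F"
    unfolding restrict_framework_def sum by (simp add: prod_eq_iff)
qed

text \<open>The part of the trimmed sum of an extension that is contributed by the theories of \<open>F\<close>, in case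
  the added theory, of credence \<open>q > k\<close>, ranks highest on \<open>a\<close>: then nothing is trimmed at the top.\<close>

definition old_part ::
  "real \<Rightarrow> real \<Rightarrow> ('a framework \<Rightarrow> 'a \<Rightarrow> 'a ethical_theory list) \<Rightarrow> 'a framework \<Rightarrow> 'a \<Rightarrow> real"
  where "old_part k q st F a = (\<Sum>t\<in>fst F.
     (if \<exists>xs ys. st F a = xs @ t # ys \<and> (\<Sum>u\<in>insert t (set xs). (1 - q) * snd F u) \<le> k
      then 0 else (1 - q) * snd F t) * t a)"

text \<open>The new theory \<open>s\<close> comes last in the list. Every suffix contains it and
  weighs at least \<open>q > k\<close>, so nothing is trimmed at the top, while bottom trimming of
  an old theory only looks at old theories before it.\<close>

lemma trimmed_sum_extend:
  assumes k: "0 \<le> k" "k < 1/2" and st: "theory_sorting st"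
    and F: "ethical_framework A F" and q: "k < q" "q < 1"
    and s: "s \<in> A \<rightarrow>\<^sub>E UNIV" and a: "a \<in> A" and top: "\<And>t. t \<in> fst F \<Longrightarrow> t a < s a"
  shows "(\<Sum>t\<in>fst (extend_framework q s F).
      trimmed_credence k st (extend_framework q s F) a t * t a) = q * s a + old_part k q st F a"
proof -
  let ?E = "extend_framework q s F"
  have q0: "0 < q" using k q by simp
  have sF: "s \<notin> fst F" using top by blast
  have fin: "finite (fst F)" and ne: "fst F \<noteq> {}" using F unfolding ethical_framework_def by auto
  have E: "ethical_framework A ?E" by (rule ethical_framework_extend[OF F q0 q(2) s sF])
  have fE: "fst ?E = insert s (fst F)" and cs: "snd ?E s = q" by (auto simp: extend_framework_def)
  have ct: "snd ?E t = (1 - q) * snd F t" if "t \<in> fst F" for t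
    using that sF by (auto simp: extend_framework_def)
  have posE: "0 \<le> snd ?E t" if "t \<in> fst ?E" for t
    using ethical_framework_pos[OF E that] by simp
  note so = theory_sortingD[OF st E a]
  obtain xs ys where l: "st ?E a = xs @ s # ys"
    using so(1) fE by (metis insertI1 split_list)
  have "ys = []"
  proof (rule ccontr)
    assume "ys \<noteq> []"
    then obtain t where t: "t \<in> set ys" by (cases ys) auto
    then have "t \<in> fst F" using so(1,2) fE l by auto
    moreover have "s a \<le> t a" using so(3) t by (auto simp: l sorted_append)
    ultimately show False using top[of t] by simp
  qed
  \<comment> \<open>Stability of \<open>st\<close> under restriction makes the old theories appear
    in the same order with and without \<open>s\<close>, however ties are broken.\<close>
  moreover have "st F a = filter (\<lambda>t. t \<in> fst F) (st ?E a)"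
    using so(4)[of "fst F"] ne fE restrict_extend[OF F q0 q(2) s sF] by auto
  moreover have "set xs = fst F" using so(1,2) fE l sF \<open>ys = []\<close> by auto
  ultimately have lE: "st ?E a = st F a @ s # []" and setF: "set (st F a) = fst F"
    using sF l by auto
  have "sum (snd ?E) (insert s (fst F)) = 1" using E fE unfolding ethical_framework_def by simp
  then have s_keep: "trimmed_credence k st ?E a s = q"
    using trim_iff[OF E k so(1,2) lE] k q cs setF unfolding trimmed_credence_def by simp
  have t_keep: "trimmed_credence k st ?E a t =
      (if \<exists>xs ys. st F a = xs @ t # ys \<and> (\<Sum>u\<in>insert t (set xs). (1 - q) * snd F u) \<le> k
       then 0 else (1 - q) * snd F t)" if t: "t \<in> fst F" for t
  proof -
    \<comment> \<open>Proved for every split of the list at \<open>t\<close>, so that it matches the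
      existential in \<open>old_part\<close>.\<close>
    have bottom: "t \<in> bottom_trim k (snd ?E) (st ?E a) \<longleftrightarrow>
        (\<Sum>u\<in>insert t (set xs). (1 - q) * snd F u) \<le> k"
      and top: "t \<notin> top_trim k (snd ?E) (st ?E a)" if l: "st F a = xs @ t # ys" for xs ys
    proof -
      have l': "st ?E a = xs @ t # (ys @ [s])" using lE l by simp
      have "insert t (set xs) \<subseteq> fst F" using l setF by auto
      then have "sum (snd ?E) (insert t (set xs)) = (\<Sum>u\<in>insert t (set xs). (1 - q) * snd F u)"
        by (intro sum.cong) (auto simp: ct)
      then show "t \<in> bottom_trim k (snd ?E) (st ?E a) \<longleftrightarrow>
          (\<Sum>u\<in>insert t (set xs). (1 - q) * snd F u) \<le> k"
        using bottom_trim_iff[OF E k so(1,2) l'] by simp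
      have "snd ?E s \<le> sum (snd ?E) (insert t (set (ys @ [s])))"
        using so(1) l' by (intro member_le_sum posE) auto
      then show "t \<notin> top_trim k (snd ?E) (st ?E a)"
        using top_trim_iff[OF E k so(1,2) l'] q cs by simp
    qed
    obtain xs ys where "st F a = xs @ t # ys" using t setF by (metis split_list)
    then have "t \<notin> top_trim k (snd ?E) (st ?E a)"
      and "t \<in> bottom_trim k (snd ?E) (st ?E a) \<longleftrightarrow>
        (\<exists>xs ys. st F a = xs @ t # ys \<and> (\<Sum>u\<in>insert t (set xs). (1 - q) * snd F u) \<le> k)"
      using bottom top by blast+
    then show ?thesis
      unfolding trimmed_credence_def Un_iff by (simp only: ct[OF t] simp_thms)
  qed
  show ?thesis
    unfolding old_part_def fE using fin sF s_keep t_keep by simp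
qed

section \<open>Fanaticism above the trimming level\<close>

lemma k_thm_fanatical:
  fixes st :: "'a framework \<Rightarrow> 'a \<Rightarrow> 'a ethical_theory list"
  assumes k: "0 \<le> k" "k < 1/2" and st: "theory_sorting st" and q: "k < q" "q < 1/2"
  shows "fanatical q (k_thm k st)"
  unfolding fanatical_def
proof (intro allI impI)
  fix A :: "'a set" and Fy :: "'a framework"
  assume "(\<exists>a\<in>A. \<exists>b\<in>A. a \<noteq> b) \<and> ethical_framework A Fy"
  then have Fy: "ethical_framework A Fy" and "\<exists>a\<in>A. \<exists>b\<in>A. a \<noteq> b" by auto
  \<comment> \<open>By totality two distinct actions can be named so that \<open>a\<close> is ranked
    at most as high as \<open>b\<close> by the old order; \<open>s\<close> will reverse
    this.\<close>
  then obtain a b where ab: "a \<in> A" "b \<in> A" "a \<noteq> b" "(a, b) \<in> k_thm k st Fy A"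
    using social_welfare_functional_k_thm[of k st]
    unfolding social_welfare_functional_def total_on_def by metis
  have q01: "0 < q" "q < 1" using k q by auto
  have fin: "finite (fst Fy)" and ne: "fst Fy \<noteq> {}" using Fy unfolding ethical_framework_def by auto
  define R where "R = old_part k q st Fy"
  \<comment> \<open>\<open>M\<close> bounds \<open>R\<close> and all old evaluations, so that
    \<open>s\<close> can outrank every old theory; the summand 1 gives \<open>N x \<ge> 1\<close>,
    hence \<open>N x\<close> is at most its square.\<close>
  define M where "M x = nat \<lceil>\<bar>R x\<bar> + (\<Sum>t\<in>fst Fy. \<bar>t x\<bar>) + 1\<rceil>" for x
  \<comment> \<open>The change at \<open>a\<close> puts \<open>N a\<close> above \<open>N b\<close>,
    which decides the lexicographic comparison.\<close>
  define N where "N = M(a := M a + M b + 1)"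
  define C where "C = 2 + 1 / q"
  define s where "s = (\<lambda>x\<in>A. C * real (N x) ^ 2 + R x)"
  have N: "\<bar>R x\<bar> + (\<Sum>t\<in>fst Fy. \<bar>t x\<bar>) + 1 \<le> N x" for x
  proof -
    have "\<bar>R x\<bar> + (\<Sum>t\<in>fst Fy. \<bar>t x\<bar>) + 1 \<le> M x" unfolding M_def by linarith
    then show ?thesis unfolding N_def by auto
  qed
  have C: "1 + 1 / q < C" "2 \<le> C" using q01 by (auto simp: C_def)
  have abs_R: "\<bar>R x\<bar> \<le> N x" for x
  proof -
    have "0 \<le> (\<Sum>t\<in>fst Fy. \<bar>t x\<bar>)" by (intro sum_nonneg) auto
    then show ?thesis using N[of x] by linarith
  qed
  have top: "t x < s x" if "x \<in> A" "t \<in> fst Fy" for x t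
  proof -
    have t: "\<bar>t x\<bar> \<le> (\<Sum>t\<in>fst Fy. \<bar>t x\<bar>)"
      using member_le_sum[of t "fst Fy" "\<lambda>t. \<bar>t x\<bar>"] that fin by simp
    have 1: "1 \<le> real (N x)" using N[of x] t by linarith
    have "2 * real (N x) \<le> C * real (N x) ^ 2"
      using C(2) 1 by (intro mult_mono) (auto simp: power2_eq_square)
    then show ?thesis using t N[of x] abs_R[of x] that(1) by (simp add: s_def)
  qed
  have s: "s \<in> A \<rightarrow>\<^sub>E UNIV" by (simp add: s_def)
  have sF: "s \<notin> fst Fy" using top[OF ab(1)] by blast
  define F where "F = extend_framework q s Fy"
  have E: "ethical_framework A F" and ext: "is_extension A Fy F"
    and res: "restrict_framework F (fst Fy) = Fy"
    unfolding F_def by (rule extend_framework[OF Fy q01 s sF])+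
  have fF: "fst F = {s} \<union> fst Fy" and cs: "snd F s = q"
    by (auto simp: F_def extend_framework_def)
  have s_le: "s x \<le> s y \<longleftrightarrow> q * s x + R x \<le> q * s y + R y" if "x \<in> A" "y \<in> A" for x y
    using square_plus_le_iff[OF q01(1) C(1) abs_R abs_R, of x y] that by (simp add: s_def)
  have val: "(\<Sum>t\<in>fst F. trimmed_credence k st F x t * t x) = q * s x + R x" if "x \<in> A" for x
    unfolding F_def R_def
    by (rule trimmed_sum_extend[OF k st Fy q(1) q01(2) s that]) (use top that in blast)
  have order_F: "k_thm k st F A = {(x, y). x \<in> A \<and> y \<in> A \<and> s x \<le> s y}"
    unfolding k_thm_def using s_le val by auto
  have order_s: "k_thm k st (restrict_framework F {s}) A = {(x, y). x \<in> A \<and> y \<in> A \<and> s x \<le> s y}"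
    by (rule k_thm_singleton[OF k st ethical_framework_restrict[OF E]])
      (auto simp: fF restrict_framework_def)
  \<comment> \<open>The squares of \<open>N a\<close> and \<open>N b\<close> differ by at least
    \<open>N a + N b\<close>. With \<open>C \<ge> 2\<close> the gap is at least twice that sum,
    while the \<open>R\<close> terms can offset it only once.\<close>
  have "s b < s a"
  proof -
    have N_ab: "real (N b) + 1 \<le> N a" using ab(3) by (simp add: N_def)
    have "real (N b) ^ 2 + (real (N b) + N a) \<le> real (N a) ^ 2"
    proof -
      have "(real (N b) + N a) * 1 \<le> (real (N b) + N a) * (real (N a) - N b)"
        using N_ab by (intro mult_left_mono) auto
      then show ?thesis by (simp add: power2_eq_square algebra_simps)
    qed
    then have "C * (real (N b) ^ 2 + (real (N b) + N a)) \<le> C * real (N a) ^ 2"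
      using C(2) by (intro mult_left_mono) auto
    moreover have "2 * (real (N b) + N a) \<le> C * (real (N b) + N a)"
      using C(2) by (intro mult_right_mono) auto
    ultimately show ?thesis
      using ab abs_R[of a] abs_R[of b] N_ab by (simp add: s_def algebra_simps)
  qed
  then have "(a, b) \<notin> k_thm k st (restrict_framework F {s}) A" unfolding order_s by simp
  moreover have "fst F - {s} = fst Fy" using fF sF by auto
  ultimately have "dominant_subset F A (k_thm k st) {s}"
    unfolding dominant_subset_def using order_F order_s res ab(4) fF ne sF by auto
  then show "\<exists>F Td. is_extension A Fy F \<and> fst F = Td \<union> fst Fy \<and> Td \<noteq> {} \<and>
      Td \<inter> fst Fy = {} \<and> dominant_subset F A (k_thm k st) Td \<and> (\<Sum>t\<in>Td. snd F t) \<le> q"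
    using ext fF sF cs by (intro exI[of _ F] exI[of _ "{s}"]) auto
qed

theorem theorem14:
  fixes k :: real and st :: "'a framework \<Rightarrow> 'a \<Rightarrow> 'a ethical_theory list"
  assumes "0 \<le> k" and "k < 1/2"
    and "theory_sorting st"
    and "\<exists>a b :: 'a. a \<noteq> b"
  shows "(\<forall>k'. 0 < k' \<and> k' < 1/2 \<and> k' \<le> k \<longrightarrow> \<not> fanatical k' (k_thm k st)) \<and>
         (\<forall>ks. 0 < ks \<and> ks < 1/2 \<and> k < ks \<longrightarrow> fanatical ks (k_thm k st))"
proof (intro conjI allI impI)
  obtain a b :: 'a where "a \<noteq> b" using assms(4) by blast
  then show "\<not> fanatical k' (k_thm k st)" if "0 < k' \<and> k' < 1/2 \<and> k' \<le> k" for k'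
    using k_thm_not_fanatical[OF assms(1-3)] that by blast
  show "fanatical ks (k_thm k st)" if "0 < ks \<and> ks < 1/2 \<and> k < ks" for ks
    using k_thm_fanatical[OF assms(1-3)] that by blast
qed

end
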